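(* Let $\mathcal C\subset\mathbb R^d$ be a relatively open set and $\mathcal Q\subset\mathbb R^d$ a vector subspace such that $\mathrm{dir}(\mathcal X^\star(\mathcal C))\subset\mathrm{dir}(\mathcal C)^\perp+\mathcal Q$. Then the algorithm described in the context outputs a set $\mathcal D\subset\mathcal Q$ of minimal cardinality among the sets $\mathcal D\subset\mathcal Q$ satisfying $\mathrm{dir}(\mathcal X^\star(\mathcal C))\subset\mathrm{dir}(\mathcal C)^\perp+\mathrm{span}\,\mathcal D$. Furthermore, its cardinality is $r(\mathcal X,\mathcal C)$.
   Context: Let $A\in\mathbb R^{m\times d}$, $b\in\mathbb R^m$, and let $\mathcal X=\{x\in\mathbb R^d: Ax=b,\ x\ge 0\}$, assumed bounded. $\mathcal X^\star(\mathcal C)=\bigcup_{c\in\mathcal C}\arg\min_{x\in\mathcal X}c^\top x$. For $S\subset\mathbb R^d$, $\mathrm{dir}(S)=\mathrm{span}\{x_1-x_2:x_1,x_2\in S\}$. $S$ is relatively open if every $x\in S$ has some $\varepsilon>0$ with $B(x,\varepsilon)\cap\mathrm{Aff}(S)\subset S$ ($\mathrm{Aff}(S)$ the affine hull, $B(x,\varepsilon)$ the open Euclidean ball). With $\mathrm{proj}_W$ the orthogonal projection onto $W$, the quantity of missing information is $$r(\mathcal X,\mathcal C)=\dim\mathrm{proj}_{\mathrm{dir}(\mathcal C)}\big(\mathrm{dir}(\mathcal X^\star(\mathcal C))\big)=\dim\mathrm{dir}(\mathcal X^\star(\mathcal C))-\dim\big(\mathrm{dir}(\mathcal X^\star(\mathcal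 C))\cap\mathrm{dir}(\mathcal C)^\perp\big).$$ Algorithm. Input: matrices $M_{1}$, $M_{2}$, $M_{\mathcal Q}$ with $d$ rows whose columns form bases of $\mathrm{dir}(\mathcal X^\star(\mathcal C))$, $\mathrm{dir}(\mathcal C)$, $\mathcal Q$ respectively. (1) Compute the projection matrix $P=M_2(M_2^\top M_2)^{-1}M_2^\top$ onto $\mathrm{dir}(\mathcal C)$. (2) By Gaussian elimination on the columns of $PM_1$, obtain a basis of $\mathrm{proj}_{\mathrm{dir}(\mathcal C)}(\mathrm{dir}(\mathcal X^\star(\mathcal C)))$; let $\tilde M\in\mathbb R^{d\times r(\mathcal X,\mathcal C)}$ be the matrix whose columns are this basis. (3) Solve the linear system $\tilde M=PM_{\mathcal Q}S$ for $S\in\mathbb R^{\dim\mathcal Q\times r(\mathcal X,\mathcal C)}$. Output: the set $\mathcal D$ of columns of $M_{\mathcal Q}S$. *)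

theory Defs
  imports "HOL-Analysis.Analysis" "Jordan_Normal_Form.Gauss_Jordan_Elimination"
begin

text \<open>
  Points of $R^d$ have type \<^typ>\<open>real ^ 'd\<close>. The matrices of the algorithm have a number of
  columns that depends on the data and may be zero, so they are matrices from
  \<^theory>\<open>Jordan_Normal_Form.Matrix\<close>. Both theories use the same notation for transposition and for
  components, hence the long names below.
\<close>

hide_type (open) Matrix.vec
hide_const (open) Matrix.mat Matrix.vec Matrix.row Matrix.orthogonal
hide_fact (open) Matrix.orthogonal_def
no_notation Matrix.vec_index (infixl \<open>$\<close> 100)
no_notation Matrix.scalar_prod (infix \<open>\<bullet>\<close> 70)

definition feasible_set :: "real ^ 'd ^ 'm \<Rightarrow> real ^ 'm \<Rightarrow> (real ^ 'd) set"
  where "feasible_set A b = {x. A *v x = b \<and> (\<forall>i. 0 \<le> x $ i)}"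

definition optimal_solutions :: "'a::real_inner set \<Rightarrow> 'a set \<Rightarrow> 'a set"
  where "optimal_solutions X C = (\<Union>c\<in>C. {x. is_arg_min (\<lambda>y. c \<bullet> y) (\<lambda>y. y \<in> X) x})"

definition dir :: "'a::real_vector set \<Rightarrow> 'a set"
  where "dir S = span {x - y | x y. x \<in> S \<and> y \<in> S}"

lemma rel_open_iff_ball:
  "rel_open S \<longleftrightarrow> (\<forall>x\<in>S. \<exists>\<epsilon>>0. ball x \<epsilon> \<inter> affine hull S \<subseteq> S)"
  for S :: "'a::euclidean_space set"
  unfolding rel_open_def using mem_rel_interior_ball by blast

definition orth_proj :: "'a::euclidean_space set \<Rightarrow> 'a \<Rightarrow> 'a"
  where "orth_proj W x = (THE y. y \<in> W \<and> x - y \<in> W\<^sup>\<bottom>)"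

lemma orth_proj_eqI:
  assumes "subspace W" "y \<in> W" "x - y \<in> W\<^sup>\<bottom>"
  shows "orth_proj W x = y"
  unfolding orth_proj_def
proof (rule the_equality)
  fix z assume z: "z \<in> W \<and> x - z \<in> W\<^sup>\<bottom>"
  have d: "z - y \<in> W" using assms z by (simp add: subspace_diff)
  have "(z - y) \<bullet> (x - y) = 0" "(z - y) \<bullet> (x - z) = 0"
    using d assms(3) z by (auto simp: orthogonal_comp_def orthogonal_def)
  then have "(z - y) \<bullet> (z - y) = 0"
    by (simp add: inner_diff_right)
  then show "z = y" by simp
qed (use assms in simp)

lemma orth_proj:
  assumes "subspace W"
  shows "orth_proj W x \<in> W" "x - orth_proj W x \<in> W\<^sup>\<bottom>"
proof -
  obtain y z where yz: "y \<in> span W" "\<And>w. w \<in> span W \<Longrightarrow> orthogonal z w" "x = y + z"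
    using orthogonal_subspace_decomp_exists[of W x] by blast
  moreover have "span W = W"
    using assms by (simp add: span_eq_iff)
  ultimately have "y \<in> W" "x - y \<in> W\<^sup>\<bottom>"
    by (auto simp: orthogonal_comp_def orthogonal_commute)
  then show "orth_proj W x \<in> W" "x - orth_proj W x \<in> W\<^sup>\<bottom>"
    using orth_proj_eqI[OF assms] by simp_all
qed

lemma linear_orth_proj:
  assumes W: "subspace W"
  shows "linear (orth_proj W)"
proof (rule linearI)
  fix x y and c :: real
  have "(x - orth_proj W x) + (y - orth_proj W y) \<in> W\<^sup>\<bottom>"
    and s: "c *\<^sub>R (x - orth_proj W x) \<in> W\<^sup>\<bottom>"
    using orth_proj[OF W] by (auto intro: subspace_add subspace_mul subspace_orthogonal_comp)
  then show "orth_proj W (x + y) = orth_proj W x + orth_proj W y"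
    using orth_proj(1)[OF W]
    by (intro orth_proj_eqI[OF W]) (auto simp: algebra_simps intro: subspace_add[OF W])
  show "orth_proj W (c *\<^sub>R x) = c *\<^sub>R orth_proj W x"
    using orth_proj(1)[OF W] s
    by (intro orth_proj_eqI[OF W]) (auto simp: algebra_simps intro: subspace_mul[OF W])
qed

definition missing_information :: "'a::euclidean_space set \<Rightarrow> 'a set \<Rightarrow> nat"
  where "missing_information X C = dim (orth_proj (dir C) ` dir (optimal_solutions X C))"

lemma missing_information_alt:
  "missing_information X C = dim (dir (optimal_solutions X C))
     - dim (dir (optimal_solutions X C) \<inter> (dir C)\<^sup>\<bottom>)"
proof -
  define W V where "W = dir C" and "V = dir (optimal_solutions X C)"
  have W: "subspace W" and V: "subspace V" by (auto simp: W_def V_def dir_def)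
  have "{x \<in> V. orth_proj W x = 0} = V \<inter> W\<^sup>\<bottom>"
  proof -
    have "x \<in> W\<^sup>\<bottom>" if "orth_proj W x = 0" for x
      using orth_proj(2)[OF W, of x] that by simp
    moreover have "orth_proj W x = 0" if "x \<in> W\<^sup>\<bottom>" for x
      using orth_proj_eqI[OF W, of 0 x] that W by (simp add: subspace_0)
    ultimately show ?thesis by blast
  qed
  moreover have "dim (orth_proj W ` V) + dim {x \<in> V. orth_proj W x = 0} = dim V"
  proof -
    define K where "K = {x \<in> V. orth_proj W x = 0}"
    define U where "U = {y \<in> V. \<forall>x\<in>K. orthogonal x y}"
    interpret f: linear "orth_proj W" by (rule linear_orth_proj[OF W])
    have K: "subspace K" "K \<subseteq> V"
      using V by (auto simp: K_def subspace_def f.zero f.add f.scale)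
    have U: "subspace U" using V by (auto simp: U_def subspace_def orthogonal_clauses)
    have "inj_on (orth_proj W) U"
    proof (rule inj_onI)
      fix x y assume xy: "x \<in> U" "y \<in> U" "orth_proj W x = orth_proj W y"
      have "x - y \<in> U" using U xy by (simp add: subspace_diff)
      moreover from this have "x - y \<in> K" using xy by (auto simp: U_def K_def f.diff)
      ultimately show "x = y" by (auto simp: U_def orthogonal_self)
    qed
    then have "dim (orth_proj W ` U) = dim U"
      using dim_image_eq[OF linear_orth_proj[OF W]] U by (metis span_eq_iff)
    moreover have "orth_proj W ` V = orth_proj W ` U"
    proof
      show "orth_proj W ` U \<subseteq> orth_proj W ` V" by (auto simp: U_def)
      show "orth_proj W ` V \<subseteq> orth_proj W ` U"
      proof
        fix p assume "p \<in> orth_proj W ` V"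
        then obtain x where x: "x \<in> V" "p = orth_proj W x" by blast
        have k: "orth_proj K x \<in> K" "x - orth_proj K x \<in> K\<^sup>\<bottom>"
          using orth_proj[OF K(1)] by auto
        then have "x - orth_proj K x \<in> U"
          using x K V by (auto simp: U_def orthogonal_comp_def subspace_diff subsetD)
        moreover have "p = orth_proj W (x - orth_proj K x)"
          using k(1) x by (simp add: f.diff K_def)
        ultimately show "p \<in> orth_proj W ` U" by blast
      qed
    qed
    ultimately show ?thesis
      using dim_subspace_orthogonal_to_vectors[OF K(1) V K(2)] by (simp add: U_def K_def)
  qed
  ultimately show ?thesis by (simp add: missing_information_def W_def V_def)
qed

text \<open>
  The map \<open>e\<close> enumerates the coordinates: row \<open>e i\<close> of a matrix holds the components with index \<open>i\<close>.
\<close>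

definition matrix_columns :: "('d::finite \<Rightarrow> nat) \<Rightarrow> real Matrix.mat \<Rightarrow> (real ^ 'd) list"
  where "matrix_columns e M = map (\<lambda>j. \<chi> i. M $$ (e i, j)) [0..<dim_col M]"

definition is_basis_matrix ::
    "('d::finite \<Rightarrow> nat) \<Rightarrow> (real ^ 'd) set \<Rightarrow> real Matrix.mat \<Rightarrow> bool"
  where "is_basis_matrix e W M \<longleftrightarrow>
    dim_row M = CARD('d) \<and> distinct (matrix_columns e M) \<and>
    independent (set (matrix_columns e M)) \<and> span (set (matrix_columns e M)) = W"

definition projection_matrix :: "real Matrix.mat \<Rightarrow> real Matrix.mat"
  where "projection_matrix M =
    M * the (mat_inverse (transpose_mat M * M)) * transpose_mat M"

text \<open>
  Elimination on the columns of \<open>B\<close> is elimination on the rows of its transpose; the nonzero rows of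
  the echelon form become the columns of the result.
\<close>

definition column_elimination :: "real Matrix.mat \<Rightarrow> real Matrix.mat"
  where "column_elimination B = mat_of_cols (dim_row B)
    (filter (\<lambda>v. v \<noteq> 0\<^sub>v (dim_row B)) (rows (gauss_jordan_single (transpose_mat B))))"

text \<open>
  A relation, since the solution \<open>S\<close> of the linear system need not be unique.
\<close>

definition algorithm_output ::
    "('d::finite \<Rightarrow> nat) \<Rightarrow> real Matrix.mat \<Rightarrow> real Matrix.mat \<Rightarrow> real Matrix.mat \<Rightarrow>
      (real ^ 'd) set \<Rightarrow> bool"
  where "algorithm_output e M\<^sub>1 M\<^sub>2 M\<^sub>Q D \<longleftrightarrow>
    (let P = projection_matrix M\<^sub>2;
         M = column_elimination (P * M\<^sub>1)
     in \<exists>S \<in> carrier_mat (dim_col M\<^sub>Q) (dim_col M).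
          M = P * M\<^sub>Q * S \<and> D = set (matrix_columns e (M\<^sub>Q * S)))"

definition sufficient_dirs :: "'a::euclidean_space set \<Rightarrow> 'a set \<Rightarrow> 'a set \<Rightarrow> bool"
  where "sufficient_dirs X C D \<longleftrightarrow>
    dir (optimal_solutions X C) \<subseteq> (dir C)\<^sup>\<bottom> + span D"

end

theory Submission
  imports Defs "Jordan_Normal_Form.Determinant"
begin

text \<open>
  Write \<open>p\<close> for the orthogonal projection onto \<open>dir C\<close> and \<open>V\<close> for the directions of the optimal
  solutions. Since \<open>p\<close> has kernel \<open>(dir C)\<^sup>\<bottom>\<close>, a set \<open>D\<close> is sufficient if and only if
  \<open>p ` V \<subseteq> span (p ` D)\<close>, so every sufficient set has at least \<open>dim (p ` V)\<close> elements. The columns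
  of the eliminated matrix are a basis of \<open>p ` V\<close>, and \<open>p\<close> maps the columns of the output matrix to
  them one by one, so the output attains the bound.
\<close>

text \<open>
  Merging with \<^theory>\<open>Jordan_Normal_Form.Determinant\<close> brings back the names and the notation that
  \<open>Defs\<close> hides.
\<close>

hide_const (open) Matrix.orthogonal
hide_fact (open) Matrix.orthogonal_def Matrix.vec_eq_iff
no_notation Matrix.vec_index (infixl \<open>$\<close> 100)
no_notation Matrix.scalar_prod (infix \<open>\<bullet>\<close> 70)

section \<open>Families of columns\<close>

text \<open>Columns are treated as an indexed family, since a set of columns would hide
  repetitions.\<close>

definition matrix_column :: "('d::finite \<Rightarrow> nat) \<Rightarrow> real Matrix.mat \<Rightarrow> nat \<Rightarrow> real ^ 'd"
  where "matrix_column e M j = (\<chi> i. M $$ (e i, j))"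

lemma matrix_columns_eq: "matrix_columns e M = map (matrix_column e M) [0..<dim_col M]"
  by (simp add: matrix_columns_def matrix_column_def)

lemma set_matrix_columns: "set (matrix_columns e M) = matrix_column e M ` {..<dim_col M}"
  by (auto simp: matrix_columns_eq)

lemma distinct_matrix_columns:
  "distinct (matrix_columns e M) \<longleftrightarrow> inj_on (matrix_column e M) {..<dim_col M}"
  by (simp add: matrix_columns_eq distinct_map atLeast0LessThan)

text \<open>Coefficients sit on indices rather than on vectors, so \<open>f\<close> may repeat
  values. In the induction, adding a multiple of \<open>f i\<close> changes only the coefficient at
  \<open>i\<close>.\<close>

lemma span_image_finite_iff:
  fixes f :: "'i \<Rightarrow> 'a::real_vector"
  assumes "finite I"
  shows "y \<in> span (f ` I) \<longleftrightarrow> (\<exists>u. y = (\<Sum>i\<in>I. u i *\<^sub>R f i))"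
proof
  assume "y \<in> span (f ` I)"
  then show "\<exists>u. y = (\<Sum>i\<in>I. u i *\<^sub>R f i)"
  proof (induction rule: span_induct_alt)
    case base
    show ?case by (rule exI[of _ "\<lambda>_. 0"]) simp
  next
    case (step c x z)
    then obtain i u where i: "i \<in> I" "x = f i" and z: "z = (\<Sum>i\<in>I. u i *\<^sub>R f i)" by blast
    have "c *\<^sub>R x = (\<Sum>k\<in>I. (if k = i then c else 0) *\<^sub>R f k)"
      using i assms by (simp add: if_distrib[of "\<lambda>a. a *\<^sub>R _"] sum.delta cong: if_cong)
    then have "c *\<^sub>R x + z = (\<Sum>k\<in>I. ((if k = i then c else 0) + u k) *\<^sub>R f k)"
      by (simp add: z scaleR_add_left sum.distrib)
    then show ?case by (rule exI[where x = "\<lambda>k. (if k = i then c else 0) + u k"])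
  qed
next
  assume "\<exists>u. y = (\<Sum>i\<in>I. u i *\<^sub>R f i)"
  then show "y \<in> span (f ` I)"
    by (auto intro!: span_sum span_scale intro: span_base)
qed

text \<open>This is linear independence of a family: a repetition is itself a nontrivial relation.
  It merges the distinctness and independence conditions of \<open>is_basis_matrix\<close> into
  one.\<close>

lemma inj_on_and_independent_image_iff:
  fixes f :: "'i \<Rightarrow> 'a::real_vector"
  assumes "finite I"
  shows "inj_on f I \<and> independent (f ` I) \<longleftrightarrow>
    (\<forall>u. (\<Sum>i\<in>I. u i *\<^sub>R f i) = 0 \<longrightarrow> (\<forall>i\<in>I. u i = 0))"
proof (intro iffI conjI allI impI ballI)
  fix u i
  assume f: "inj_on f I \<and> independent (f ` I)" and u: "(\<Sum>i\<in>I. u i *\<^sub>R f i) = 0" and i: "i \<in> I"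
  let ?g = "the_inv_into I f"
  have "(\<Sum>x\<in>f ` I. u (?g x) *\<^sub>R x) = 0"
    using f u by (simp add: sum.reindex the_inv_into_f_f)
  then have "u (?g (f i)) = 0"
    using f i assms independentD[of "f ` I" "f ` I" "\<lambda>x. u (?g x)" "f i"] by blast
  then show "u i = 0" using f i by (simp add: the_inv_into_f_f)
next
  assume z: "\<forall>u. (\<Sum>i\<in>I. u i *\<^sub>R f i) = 0 \<longrightarrow> (\<forall>i\<in>I. u i = 0)"
  show inj: "inj_on f I"
  proof (rule inj_onI, rule ccontr)
    fix i j assume ij: "i \<in> I" "j \<in> I" "f i = f j" "i \<noteq> j"
    \<comment> \<open>Coefficients 1 at \<open>i\<close> and -1 at \<open>j\<close> encode the
      relation \<open>f i - f j = 0\<close>.\<close>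
    let ?u = "\<lambda>k. (if k = i then 1 else 0) - (if k = j then 1 else 0 :: real)"
    have "(\<Sum>k\<in>I. ?u k *\<^sub>R f k) = 0"
      using ij assms
      by (simp add: scaleR_diff_left sum_subtractf if_distrib[of "\<lambda>a. a *\<^sub>R _"] cong: if_cong)
    then have "?u i = 0" using z[rule_format, of ?u i] ij(1) by blast
    then show False using ij(4) by simp
  qed
  show "independent (f ` I)"
  proof (rule independent_if_scalars_zero)
    fix g x assume "(\<Sum>x\<in>f ` I. g x *\<^sub>R x) = 0" "x \<in> f ` I"
    then have "(\<Sum>i\<in>I. g (f i) *\<^sub>R f i) = 0" using inj by (simp add: sum.reindex)
    then show "g x = 0" using z \<open>x \<in> f ` I\<close> by auto
  qed (use assms in simp)
qed

section \<open>Matrix products and column spaces\<close>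

lemma coordinate_less:
  assumes "bij_betw e (UNIV :: 'd::finite set) {..<CARD('d)}"
  shows "e i < CARD('d)"
  using assms bij_betwE by blast

lemma matrix_column_mult:
  fixes e :: "'d::finite \<Rightarrow> nat"
  assumes e: "bij_betw e UNIV {..<CARD('d)}"
    and A: "A \<in> carrier_mat CARD('d) n" and B: "B \<in> carrier_mat n m" and j: "j < m"
  shows "matrix_column e (A * B) j = (\<Sum>k<n. B $$ (k, j) *\<^sub>R matrix_column e A k)"
  using coordinate_less[OF e] A B j
  by (simp add: matrix_column_def vec_eq_iff scalar_prod_def atLeast0LessThan mult.commute)

lemma matrix_column_mult_in_span:
  fixes e :: "'d::finite \<Rightarrow> nat"
  assumes e: "bij_betw e UNIV {..<CARD('d)}"
    and A: "A \<in> carrier_mat CARD('d) n" and B: "B \<in> carrier_mat n m" and j: "j < m"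
  shows "matrix_column e (A * B) j \<in> span (set (matrix_columns e A))"
  using A unfolding matrix_column_mult[OF assms] set_matrix_columns
  by (auto intro!: span_sum span_scale intro: span_base)

lemma span_matrix_columns_mult_subset:
  fixes e :: "'d::finite \<Rightarrow> nat"
  assumes "bij_betw e UNIV {..<CARD('d)}"
    and "A \<in> carrier_mat CARD('d) n" "B \<in> carrier_mat n m"
  shows "span (set (matrix_columns e (A * B))) \<subseteq> span (set (matrix_columns e A))"
  using assms matrix_column_mult_in_span[OF assms]
  by (intro span_minimal) (auto simp: set_matrix_columns)

text \<open>Reindexing along \<open>e\<close> turns the sum over coordinates in the inner product
  into the sum over row numbers in the matrix product.\<close>

lemma inner_matrix_column:
  fixes e :: "'d::finite \<Rightarrow> nat"
  assumes e: "bij_betw e UNIV {..<CARD('d)}"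
    and A: "A \<in> carrier_mat CARD('d) n" "j < n" and B: "B \<in> carrier_mat CARD('d) m" "k < m"
  shows "matrix_column e A j \<bullet> matrix_column e B k = (transpose_mat A * B) $$ (j, k)"
proof -
  have "(\<Sum>i\<in>UNIV. A $$ (e i, j) * B $$ (e i, k)) = (\<Sum>i<CARD('d). A $$ (i, j) * B $$ (i, k))"
    by (rule sum.reindex_bij_betw[OF e])
  then show ?thesis
    using A B by (simp add: matrix_column_def inner_vec_def scalar_prod_def atLeast0LessThan)
qed

lemma mat_eq_if_matrix_columns_eq:
  fixes e :: "'d::finite \<Rightarrow> nat"
  assumes e: "bij_betw e UNIV {..<CARD('d)}"
    and A: "A \<in> carrier_mat CARD('d) n" and B: "B \<in> carrier_mat CARD('d) n"
    and eq: "\<And>j. j < n \<Longrightarrow> matrix_column e A j = matrix_column e B j"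
  shows "A = B"
proof (rule eq_matI)
  fix i j assume "i < dim_row B" "j < dim_col B"
  then have ij: "i < CARD('d)" "j < n" using B by auto
  then obtain i' where "i = e i'" using e by (auto simp: bij_betw_def)
  then show "A $$ (i, j) = B $$ (i, j)"
    using eq[OF ij(2)] by (auto simp: matrix_column_def vec_eq_iff)
qed (use A B in auto)

text \<open>The coefficients expressing the columns of \<open>M\<close> through those of
  \<open>A\<close> form the columns of \<open>S\<close>. This gives solvability of the linear system
  in the algorithm.\<close>

lemma ex_mat_mult_if_columns_in_span:
  fixes e :: "'d::finite \<Rightarrow> nat"
  assumes e: "bij_betw e UNIV {..<CARD('d)}"
    and A: "A \<in> carrier_mat CARD('d) n" and M: "M \<in> carrier_mat CARD('d) m"
    and sub: "set (matrix_columns e M) \<subseteq> span (set (matrix_columns e A))"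
  shows "\<exists>S \<in> carrier_mat n m. M = A * S"
proof -
  have "\<exists>u. matrix_column e M j = (\<Sum>k<n. u k *\<^sub>R matrix_column e A k)" if "j < m" for j
  proof -
    have "matrix_column e M j \<in> span (matrix_column e A ` {..<n})"
      using sub that A M by (auto simp: set_matrix_columns)
    then show ?thesis by (simp add: span_image_finite_iff)
  qed
  then obtain u where u: "\<And>j. j < m \<Longrightarrow>
      matrix_column e M j = (\<Sum>k<n. u j k *\<^sub>R matrix_column e A k)"
    by metis
  define S where "S = Matrix.mat n m (\<lambda>(k, j). u j k)"
  have S: "S \<in> carrier_mat n m" by (simp add: S_def)
  have "M = A * S"
  proof (rule mat_eq_if_matrix_columns_eq[OF e M])
    show "A * S \<in> carrier_mat CARD('d) m" using A S by simp
    show "matrix_column e M j = matrix_column e (A * S) j" if "j < m" for j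
      using that by (simp add: u matrix_column_mult[OF e A S]) (simp add: S_def)
  qed
  with S show ?thesis by blast
qed

section \<open>The projection matrix\<close>

text \<open>A kernel vector \<open>v\<close> of the Gram matrix yields a combination of the columns
  that is orthogonal to every column, hence to itself. So it vanishes, and independence gives
  \<open>v = 0\<close>. Thus \<open>the\<close> in \<open>projection_matrix\<close> selects a
  genuine inverse.\<close>

lemma gram_mat_inverse:
  fixes e :: "'d::finite \<Rightarrow> nat"
  assumes e: "bij_betw e UNIV {..<CARD('d)}" and M: "is_basis_matrix e W M"
  obtains N where "mat_inverse (transpose_mat M * M) = Some N"
    "N \<in> carrier_mat (dim_col M) (dim_col M)"
    "transpose_mat M * M * N = 1\<^sub>m (dim_col M)"
proof -
  define n where "n = dim_col M"
  define G where "G = transpose_mat M * M"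
  have Mc: "M \<in> carrier_mat CARD('d) n" using M by (auto simp: is_basis_matrix_def n_def)
  then have G: "G \<in> carrier_mat n n" by (simp add: G_def)
  have "det G \<noteq> 0"
  proof
    assume "det G = 0"
    then obtain v where v: "v \<in> carrier_vec n" "v \<noteq> 0\<^sub>v n" and Gv: "G *\<^sub>v v = 0\<^sub>v n"
      using det_0_iff_vec_prod_zero_field[OF G] by blast
    let ?c = "matrix_column e M" and ?v = "vec_index v"
    define y where "y = (\<Sum>k<n. ?v k *\<^sub>R ?c k)"
    have "?c j \<bullet> y = 0" if "j < n" for j
    proof -
      have "?c j \<bullet> y = (\<Sum>k<n. G $$ (j, k) * ?v k)"
        using that
        by (simp add: y_def inner_sum_right inner_matrix_column[OF e Mc _ Mc] G_def mult.commute)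
      also have "\<dots> = vec_index (G *\<^sub>v v) j"
        using that G v by (simp add: scalar_prod_def atLeast0LessThan)
      finally show ?thesis using that by (simp add: Gv)
    qed
    then have "y \<bullet> y = 0"
      unfolding y_def by (subst (1) inner_sum_left) (auto simp: y_def)
    then have "(\<Sum>k<n. ?v k *\<^sub>R ?c k) = 0" by (simp add: y_def)
    then have "\<forall>k<n. ?v k = 0"
      using M inj_on_and_independent_image_iff[of "{..<n}" ?c]
      by (auto simp: is_basis_matrix_def distinct_matrix_columns set_matrix_columns n_def)
    then have "v = 0\<^sub>v n" using v(1) by (intro eq_vecI) auto
    with v(2) show False by blast
  qed
  \<comment> \<open>The argument \<open>()\<close> fills the extension slot of the matrix ring
    record, so that both facts concern the same ring.\<close>
  then have "mat_inverse G \<noteq> None"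
    using det_non_zero_imp_unit[OF G, of "()"] mat_inverse(1)[OF G, of "()"] by blast
  then obtain N where "mat_inverse G = Some N" by blast
  with mat_inverse(2)[OF G this] show ?thesis
    by (intro that[of N]) (auto simp: G_def n_def)
qed

lemma projection_matrix_carrier:
  fixes e :: "'d::finite \<Rightarrow> nat"
  assumes M: "is_basis_matrix e W M"
  shows "projection_matrix M \<in> carrier_mat CARD('d) CARD('d)"
  using M by (auto simp: projection_matrix_def is_basis_matrix_def)

text \<open>The product equals \<open>M * R\<close>, whose columns lie in \<open>W\<close>. By the
  normal equations, their differences from the columns of \<open>B\<close> are orthogonal to
  \<open>W\<close>. These two properties characterize the orthogonal projection.\<close>

lemma matrix_column_projection:
  fixes e :: "'d::finite \<Rightarrow> nat"
  assumes e: "bij_betw e UNIV {..<CARD('d)}" and M: "is_basis_matrix e W M"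
    and B: "B \<in> carrier_mat CARD('d) m" and j: "j < m"
  shows "matrix_column e (projection_matrix M * B) j = orth_proj W (matrix_column e B j)"
proof -
  define n where "n = dim_col M"
  have Mc: "M \<in> carrier_mat CARD('d) n" and W: "W = span (set (matrix_columns e M))"
    using M by (auto simp: is_basis_matrix_def n_def)
  obtain N where inv: "mat_inverse (transpose_mat M * M) = Some N"
    and N: "N \<in> carrier_mat n n" and GN: "transpose_mat M * M * N = 1\<^sub>m n"
    using gram_mat_inverse[OF e M] by (metis n_def)
  have T: "transpose_mat M \<in> carrier_mat n CARD('d)" using Mc by simp
  \<comment> \<open>Column \<open>j\<close> of \<open>R\<close> holds coefficients of the projected
    column \<open>j\<close> of \<open>B\<close> with respect to the columns of
    \<open>M\<close>.\<close>
  define R where "R = N * (transpose_mat M * B)"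
  have TB: "transpose_mat M * B \<in> carrier_mat n m" using T B by simp
  have R: "R \<in> carrier_mat n m" using N TB by (simp add: R_def)
  have PB: "projection_matrix M * B = M * R"
    using Mc N T B unfolding projection_matrix_def inv R_def
    by (simp add: assoc_mult_mat[of _ "CARD('d)" n _ "CARD('d)" _ m]
        assoc_mult_mat[of _ "CARD('d)" n _ n]
        assoc_mult_mat[of _ n n _ "CARD('d)" _ m])
  have "transpose_mat M * (M * R) = transpose_mat M * M * R"
    using assoc_mult_mat[OF T Mc R] by simp
  also have "\<dots> = transpose_mat M * M * N * (transpose_mat M * B)"
    unfolding R_def by (rule assoc_mult_mat[OF mult_carrier_mat[OF T Mc] N TB, symmetric])
  also have "\<dots> = transpose_mat M * B" by (simp only: GN left_mult_one_mat[OF TB])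
  finally have normal: "transpose_mat M * (M * R) = transpose_mat M * B" .
  have MR: "M * R \<in> carrier_mat CARD('d) m" using Mc R by simp
  let ?x = "matrix_column e B j" and ?y = "matrix_column e (M * R) j"
  have "orth_proj W ?x = ?y"
  proof (rule orth_proj_eqI)
    show "subspace W" by (simp add: W)
    show "?y \<in> W" using matrix_column_mult_in_span[OF e Mc R j] by (simp add: W)
    have "matrix_column e M k \<bullet> (?x - ?y) = 0" if "k < n" for k
      using that
      by (simp add: inner_diff_right inner_matrix_column[OF e Mc that B j]
          inner_matrix_column[OF e Mc that MR j] normal)
    then have "orthogonal (?x - ?y) z" if "z \<in> set (matrix_columns e M)" for z
      using that Mc by (auto simp: set_matrix_columns orthogonal_def inner_commute)
    then have "orthogonal (?x - ?y) z" if "z \<in> W" for z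
      using orthogonal_to_span that unfolding W by blast
    then show "?x - ?y \<in> W\<^sup>\<bottom>"
      by (auto simp: orthogonal_comp_def orthogonal_commute)
  qed
  then show ?thesis by (simp add: PB)
qed

lemma span_projection_matrix_mult:
  fixes e :: "'d::finite \<Rightarrow> nat"
  assumes e: "bij_betw e UNIV {..<CARD('d)}" and M: "is_basis_matrix e W M"
    and B: "is_basis_matrix e V B"
  shows "span (set (matrix_columns e (projection_matrix M * B))) = orth_proj W ` V"
proof -
  have Bc: "B \<in> carrier_mat CARD('d) (dim_col B)" and V: "V = span (set (matrix_columns e B))"
    using B by (auto simp: is_basis_matrix_def)
  have W: "subspace W" using M by (auto simp: is_basis_matrix_def)
  have "set (matrix_columns e (projection_matrix M * B)) = orth_proj W ` set (matrix_columns e B)"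
    using matrix_column_projection[OF e M Bc]
    by (auto simp: set_matrix_columns image_image intro!: image_cong)
  then show ?thesis
    using linear_span_image[OF linear_orth_proj[OF W]] by (simp add: V)
qed

section \<open>Column elimination\<close>

text \<open>A pivot position equal to \<open>dim_col R\<close> marks a zero row. Any other row has a
  pivot 1, the only nonzero entry of its column.\<close>

lemma row_echelon_form_nonzero_rows:
  assumes R: "row_echelon_form R"
  obtains p where "\<And>i. i < dim_row R \<Longrightarrow> Matrix.row R i \<noteq> 0\<^sub>v (dim_col R) \<Longrightarrow>
      p i < dim_col R \<and> R $$ (i, p i) = 1 \<and>
      (\<forall>i'<dim_row R. i' \<noteq> i \<longrightarrow> R $$ (i', p i) = 0)"
proof -
  from R obtain p where p: "pivot_fun R p (dim_col R)"
    by (auto simp: row_echelon_form_def)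
  note pD = pivot_funD[OF refl p]
  have "p i < dim_col R" if i: "i < dim_row R" "Matrix.row R i \<noteq> 0\<^sub>v (dim_col R)" for i
  proof (rule ccontr)
    assume "\<not> p i < dim_col R"
    then have "Matrix.row R i = 0\<^sub>v (dim_col R)"
      using pD(2)[OF i(1)] i(1) by (intro eq_vecI) auto
    with i(2) show False by blast
  qed
  with pD(4,5) show ?thesis by (intro that[of p]) auto
qed

lemma matrix_column_mat_of_cols:
  fixes e :: "'d::finite \<Rightarrow> nat"
  assumes "bij_betw e UNIV {..<CARD('d)}" "j < length vs"
  shows "matrix_column e (mat_of_cols CARD('d) vs) j = (\<chi> i. vec_index (vs ! j) (e i))"
  using coordinate_less[OF assms(1)] assms(2)
  by (simp add: matrix_column_def mat_of_cols_index)

text \<open>Row operations on the transpose are invertible, so they preserve the column span of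
  \<open>B\<close>, and discarding zero rows preserves it too. Independence and distinctness of the
  remaining rows are read off at their pivots.\<close>

lemma is_basis_matrix_column_elimination:
  fixes e :: "'d::finite \<Rightarrow> nat"
  assumes e: "bij_betw e UNIV {..<CARD('d)}" and B: "B \<in> carrier_mat CARD('d) m"
  shows "is_basis_matrix e (span (set (matrix_columns e B))) (column_elimination B)"
proof -
  define R where "R = gauss_jordan_single (transpose_mat B)"
  have BT: "transpose_mat B \<in> carrier_mat m CARD('d)" using B by simp
  note gj = gauss_jordan_single[OF BT R_def[symmetric]]
  have R: "R \<in> carrier_mat m CARD('d)" by (rule gj(2))
  \<comment> \<open>With the inverse \<open>L'\<close> at hand, each of \<open>B\<close> and the
    transpose of \<open>R\<close> is the other times a matrix, which gives both inclusions of
    spans.\<close>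
  obtain L L' where RL: "R = L * transpose_mat B" and L: "L \<in> carrier_mat m m"
    and L': "L' \<in> carrier_mat m m" and LL: "L' * L = 1\<^sub>m m"
    using gj(4) by blast
  have RT: "transpose_mat R \<in> carrier_mat CARD('d) m" using R by simp
  have "transpose_mat R = B * transpose_mat L"
    unfolding RL using transpose_mult[OF L BT] by simp
  then have "span (set (matrix_columns e (transpose_mat R))) \<subseteq> span (set (matrix_columns e B))"
    using span_matrix_columns_mult_subset[OF e B, of "transpose_mat L" m] L by simp
  moreover have "L' * R = transpose_mat B"
    unfolding RL using assoc_mult_mat[OF L' L BT] BT by (simp add: LL)
  then have "B = transpose_mat R * transpose_mat L'"
    using transpose_mult[OF L' R] by simp
  then have "span (set (matrix_columns e B)) \<subseteq> span (set (matrix_columns e (transpose_mat R)))"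
    using span_matrix_columns_mult_subset[OF e RT, of "transpose_mat L'" m] L' by simp
  ultimately have spanR:
    "span (set (matrix_columns e (transpose_mat R))) = span (set (matrix_columns e B))" by blast

  define P where "P i \<longleftrightarrow> Matrix.row R i \<noteq> 0\<^sub>v CARD('d)" for i
  define ks where "ks = filter P [0..<m]"
  let ?c = "matrix_column e (transpose_mat R)"
  have c: "?c i = (\<chi> k. R $$ (i, e k))" if "i < m" for i
    using that R coordinate_less[OF e] by (simp add: matrix_column_def)
  have CE: "column_elimination B = mat_of_cols CARD('d) (map (Matrix.row R) ks)"
    using B R by (simp add: column_elimination_def R_def[symmetric] ks_def P_def[abs_def] rows_def
        filter_map o_def)
  have "matrix_column e (column_elimination B) j = ?c (ks ! j)" if "j < length ks" for j
  proof -
    have "ks ! j \<in> set ks" using that by simp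
    then have "ks ! j < m" by (simp add: ks_def)
    then show ?thesis
      using that R coordinate_less[OF e]
      by (simp add: CE matrix_column_mat_of_cols[OF e] c)
  qed
  then have cols: "matrix_columns e (column_elimination B) = map ?c ks"
    by (intro nth_equalityI) (auto simp: matrix_columns_eq CE)

  obtain p where p: "\<And>i. i < m \<Longrightarrow> P i \<Longrightarrow> p i < CARD('d) \<and> R $$ (i, p i) = 1 \<and>
      (\<forall>i'<m. i' \<noteq> i \<longrightarrow> R $$ (i', p i) = 0)"
    using row_echelon_form_nonzero_rows[OF gj(3)] R unfolding P_def by (metis carrier_matD)
  have zero: "u i = 0" if u: "(\<Sum>i\<in>set ks. u i *\<^sub>R ?c i) = 0" and i: "i \<in> set ks" for u i
  proof -
    have im: "i < m" "P i" using i by (auto simp: ks_def)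
    \<comment> \<open>At the coordinate \<open>k\<close> of the pivot of row \<open>i\<close>, the
      relation retains only the term \<open>u i\<close>.\<close>
    obtain k where k: "p i = e k" using p[OF im] e by (auto simp: bij_betw_def)
    have "0 = (\<Sum>i'\<in>set ks. u i' * R $$ (i', p i))"
      using arg_cong[OF u, of "\<lambda>v. v $ k"] by (simp add: c k ks_def)
    also have "\<dots> = (\<Sum>i'\<in>set ks. if i' = i then u i' else 0)"
      using p[OF im] by (intro sum.cong) (auto simp: ks_def)
    also have "\<dots> = u i" using i by simp
    finally show ?thesis by simp
  qed
  have "inj_on ?c (set ks) \<and> independent (?c ` set ks)"
    using zero by (subst inj_on_and_independent_image_iff) auto
  moreover have "distinct ks" by (simp add: ks_def)
  moreover have "span (?c ` set ks) = span (set (matrix_columns e (transpose_mat R)))"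
  proof (rule antisym)
    show "span (?c ` set ks) \<subseteq> span (set (matrix_columns e (transpose_mat R)))"
      using R by (intro span_mono) (auto simp: set_matrix_columns ks_def)
    have "?c i \<in> span (?c ` set ks)" if i: "i < m" for i
    proof (cases "P i")
      case True
      then show ?thesis using i by (auto simp: ks_def intro: span_base)
    next
      case False
      have "R $$ (i, e k) = 0" for k
        using False i R coordinate_less[OF e]
        by (metis P_def carrier_matD index_row(1) index_zero_vec(1))
      then have "?c i = 0" using i by (simp add: c vec_eq_iff)
      then show ?thesis by (simp add: span_zero)
    qed
    then show "span (set (matrix_columns e (transpose_mat R))) \<subseteq> span (?c ` set ks)"
      using R by (intro span_minimal) (auto simp: set_matrix_columns)
  qed
  moreover have "dim_row (column_elimination B) = CARD('d)" by (simp add: CE)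
  ultimately show ?thesis
    by (simp add: is_basis_matrix_def cols distinct_map spanR)
qed

section \<open>Sufficiency of directions\<close>

text \<open>The kernel of the projection is the orthogonal complement of \<open>W\<close>, so
  \<open>v\<close> lies in the sum exactly when it has the same projection as some element of
  \<open>U\<close>.\<close>

lemma sub_orthogonal_plus_iff:
  assumes W: "subspace W"
  shows "V \<subseteq> W\<^sup>\<bottom> + U \<longleftrightarrow> orth_proj W ` V \<subseteq> orth_proj W ` U"
proof -
  interpret p: linear "orth_proj W" by (rule linear_orth_proj[OF W])
  have ker: "orth_proj W x = 0 \<longleftrightarrow> x \<in> W\<^sup>\<bottom>" for x
    using orth_proj(2)[OF W, of x] orth_proj_eqI[OF W subspace_0[OF W], of x] by auto
  have "v \<in> W\<^sup>\<bottom> + U \<longleftrightarrow> orth_proj W v \<in> orth_proj W ` U" for v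
  proof
    assume "v \<in> W\<^sup>\<bottom> + U"
    then obtain w u where "w \<in> W\<^sup>\<bottom>" "u \<in> U" "v = w + u" by (auto elim: set_plus_elim)
    then show "orth_proj W v \<in> orth_proj W ` U" by (simp add: p.add ker[symmetric])
  next
    assume "orth_proj W v \<in> orth_proj W ` U"
    then obtain u where u: "u \<in> U" "orth_proj W v = orth_proj W u" by blast
    then have "v - u \<in> W\<^sup>\<bottom>" by (simp add: ker[symmetric] p.diff)
    then show "v \<in> W\<^sup>\<bottom> + U" using set_plus_intro[OF _ u(1), of "v - u"] by simp
  qed
  then show ?thesis by blast
qed

text \<open>By linearity the projection commutes with \<open>span\<close>. Sufficiency becomes a
  spanning condition on projected vectors, where dimension bounds cardinality from below.\<close>

lemma sufficient_dirs_iff: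
  "sufficient_dirs X C D \<longleftrightarrow>
    orth_proj (dir C) ` dir (optimal_solutions X C) \<subseteq> span (orth_proj (dir C) ` D)"
proof -
  have W: "subspace (dir C)" by (simp add: dir_def)
  show ?thesis
    unfolding sufficient_dirs_def sub_orthogonal_plus_iff[OF W]
      linear_span_image[OF linear_orth_proj[OF W]] ..
qed

theorem proposition8:
  fixes A :: "real ^ 'd ^ 'm" and b :: "real ^ 'm"
    and C Q :: "(real ^ 'd) set"
    and e :: "'d \<Rightarrow> nat" and M\<^sub>1 M\<^sub>2 M\<^sub>Q :: "real Matrix.mat"
  defines "X \<equiv> feasible_set A b"
  assumes "bounded X"
    and "rel_open C"
    and "subspace Q"
    and "dir (optimal_solutions X C) \<subseteq> (dir C)\<^sup>\<bottom> + Q"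
    and "bij_betw e UNIV {..<CARD('d)}"
    and "is_basis_matrix e (dir (optimal_solutions X C)) M\<^sub>1"
    and "is_basis_matrix e (dir C) M\<^sub>2"
    and "is_basis_matrix e Q M\<^sub>Q"
  shows "(\<exists>D. algorithm_output e M\<^sub>1 M\<^sub>2 M\<^sub>Q D) \<and>
    (\<forall>D. algorithm_output e M\<^sub>1 M\<^sub>2 M\<^sub>Q D \<longrightarrow>
      D \<subseteq> Q \<and> finite D \<and> sufficient_dirs X C D \<and>
      (\<forall>D'. D' \<subseteq> Q \<and> finite D' \<and> sufficient_dirs X C D' \<longrightarrow> card D \<le> card D') \<and>
      card D = missing_information X C)"
proof -
  note e = assms(6) and M1 = assms(7) and M2 = assms(8) and MQ = assms(9)
  define V where "V = dir (optimal_solutions X C)"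
  define p where "p = orth_proj (dir C)"
  define P where "P = projection_matrix M\<^sub>2"
  define M where "M = column_elimination (P * M\<^sub>1)"
  have P: "P \<in> carrier_mat CARD('d) CARD('d)"
    unfolding P_def by (rule projection_matrix_carrier[OF M2])
  have MQc: "M\<^sub>Q \<in> carrier_mat CARD('d) (dim_col M\<^sub>Q)"
    and PM1: "P * M\<^sub>1 \<in> carrier_mat CARD('d) (dim_col M\<^sub>1)"
    using MQ M1 P by (auto simp: is_basis_matrix_def)
  have PMQ: "P * M\<^sub>Q \<in> carrier_mat CARD('d) (dim_col M\<^sub>Q)"
    by (rule mult_carrier_mat[OF P MQc])
  have W: "subspace (dir C)" by (simp add: dir_def)
  have M: "is_basis_matrix e (p ` V) M"
    using is_basis_matrix_column_elimination[OF e PM1] span_projection_matrix_mult[OF e M2 M1]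
    by (simp add: M_def P_def p_def V_def)
  then have Mc: "M \<in> carrier_mat CARD('d) (dim_col M)"
    and spanM: "span (set (matrix_columns e M)) = p ` V"
    and indM: "independent (set (matrix_columns e M))"
    and distM: "distinct (matrix_columns e M)"
    by (auto simp: is_basis_matrix_def)
  \<comment> \<open>Projecting the assumption on \<open>Q\<close> places the columns of
    \<open>M\<close> in the column space of \<open>P * M\<^sub>Q\<close>, so a solution
    \<open>S\<close> exists.\<close>
  have "p ` V \<subseteq> p ` Q"
    using assms(5) sub_orthogonal_plus_iff[OF W] by (simp add: V_def p_def)
  then have "set (matrix_columns e M) \<subseteq> span (set (matrix_columns e (P * M\<^sub>Q)))"
    using span_superset[of "set (matrix_columns e M)"]
    unfolding spanM P_def span_projection_matrix_mult[OF e M2 MQ] p_def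
    by (rule order_trans[rotated])
  then have "\<exists>S \<in> carrier_mat (dim_col M\<^sub>Q) (dim_col M). M = P * M\<^sub>Q * S"
    by (rule ex_mat_mult_if_columns_in_span[OF e PMQ Mc])
  then have ex: "\<exists>D. algorithm_output e M\<^sub>1 M\<^sub>2 M\<^sub>Q D"
    unfolding algorithm_output_def Let_def P_def[symmetric] M_def[symmetric] by blast
  have missing: "missing_information X C = card (set (matrix_columns e M))"
    using dim_span_eq_card_independent[OF indM] spanM
    by (simp add: missing_information_def p_def V_def)
  have "D \<subseteq> Q \<and> finite D \<and> sufficient_dirs X C D \<and>
      (\<forall>D'. D' \<subseteq> Q \<and> finite D' \<and> sufficient_dirs X C D' \<longrightarrow> card D \<le> card D') \<and>
      card D = missing_information X C" if alg: "algorithm_output e M\<^sub>1 M\<^sub>2 M\<^sub>Q D" for D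
  proof -
    from alg obtain S where S: "S \<in> carrier_mat (dim_col M\<^sub>Q) (dim_col M)"
      and MS: "M = P * M\<^sub>Q * S" and D: "D = set (matrix_columns e (M\<^sub>Q * S))"
      unfolding algorithm_output_def Let_def P_def[symmetric] M_def[symmetric] by blast
    have MQS: "M\<^sub>Q * S \<in> carrier_mat CARD('d) (dim_col M)"
      by (rule mult_carrier_mat[OF MQc S])
    \<comment> \<open>Regrouping the product makes the columns of \<open>M\<close> the projections
      of the output columns, index by index.\<close>
    have "M = P * (M\<^sub>Q * S)" using MS assoc_mult_mat[OF P MQc S] by simp
    then have "matrix_column e M j = p (matrix_column e (M\<^sub>Q * S) j)" if "j < dim_col M" for j
      using matrix_column_projection[OF e M2 MQS that] by (simp add: P_def p_def)
    then have pD: "set (matrix_columns e M) = p ` D"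
      using MQS by (auto simp: D set_matrix_columns image_image intro!: image_cong)
    have fin: "finite D" by (simp add: D)
    \<comment> \<open>The output has \<open>dim_col M\<close> columns, a priori with repetitions.
      Their projections are that many distinct vectors, so none occur.\<close>
    have "card D \<le> dim_col M"
      using card_length[of "matrix_columns e (M\<^sub>Q * S)"] S by (simp add: D matrix_columns_eq)
    moreover have "card (p ` D) = dim_col M"
      using distinct_card[OF distM] unfolding pD by (simp add: matrix_columns_eq)
    ultimately have card: "card D = card (p ` D)"
      using card_image_le[OF fin, of p] by simp
    have "card D \<le> card D'" if "finite D'" "sufficient_dirs X C D'" for D'
    proof -
      have "p ` V \<subseteq> span (p ` D')" using that(2) by (simp add: sufficient_dirs_iff p_def V_def)
      then have "dim (p ` V) \<le> card (p ` D')" using that(1) by (intro dim_le_card) auto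
      also have "\<dots> \<le> card D'" by (rule card_image_le[OF that(1)])
      finally show ?thesis
        using missing card pD by (simp add: missing_information_def p_def V_def)
    qed
    moreover have "D \<subseteq> Q"
      using span_matrix_columns_mult_subset[OF e MQc S] span_superset MQ
      unfolding D is_basis_matrix_def by blast
    moreover have "sufficient_dirs X C D"
      using spanM by (simp add: sufficient_dirs_iff pD p_def V_def)
    ultimately show ?thesis using fin missing card pD by simp
  qed
  with ex show ?thesis by blast
qed

end
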